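(* Let $X$ be a locally convex real vector space and let $T : X \to X$ be a continuous linear operator that is hypercyclic. Then there exists a linear subspace $\mathcal{M} \subseteq X$ that is dense in $X$ and invariant under $T$ (that is, $T(\mathcal{M}) \subseteq \mathcal{M}$), and such that every non-zero vector of $\mathcal{M}$ is a hypercyclic vector for $T$.
   Context: Let $X$ be a locally convex vector space and $T : X \to X$ a continuous linear operator. For $x \in X$, the orbit of $x$ under $T$ is $\mathrm{Orb}\{x, T\} = \{x, Tx, T^2x, \dots\}$. The operator $T$ is called hypercyclic if there exists some $x \in X$ whose orbit $\mathrm{Orb}\{x,T\}$ is dense in $X$; such an $x$ is called a hypercyclic vector for $T$. *)

theory Defs
  imports "HOL-Analysis.Analysis"
begin

text \<open>
  Real locally convex spaces: real topological vector spaces with a neighbourhood base of convex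
  sets at 0.  The Hausdorff axiom is deliberately not required.  Convexity is spelled out because a
  class specification cannot mention \<^const>\<open>convex\<close>; see the lemma below.
\<close>

class locally_convex_space = real_vector + topological_ab_group_add +
  assumes tendsto_scaleR_Pair:
    "LIM p (nhds c \<times>\<^sub>F nhds x). fst p *\<^sub>R snd p :> nhds (c *\<^sub>R x)"
  assumes convex_nhds_base:
    "open U \<Longrightarrow> 0 \<in> U \<Longrightarrow> \<exists>V. open V \<and> 0 \<in> V \<and> V \<subseteq> U \<and>
      (\<forall>x\<in>V. \<forall>y\<in>V. \<forall>u\<ge>0. \<forall>v\<ge>0. u + v = 1 \<longrightarrow> u *\<^sub>R x + v *\<^sub>R y \<in> V)"

lemma locally_convex:
  fixes U :: "'a::locally_convex_space set"
  assumes "open U" "0 \<in> U"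
  shows "\<exists>V. open V \<and> 0 \<in> V \<and> V \<subseteq> U \<and> convex V"
  using convex_nhds_base[OF assms] unfolding convex_def .

instance real_normed_vector \<subseteq> locally_convex_space
proof
  fix c :: real and x :: 'a
  show "LIM p (nhds c \<times>\<^sub>F nhds x). fst p *\<^sub>R snd p :> nhds (c *\<^sub>R x)"
    by (intro tendsto_scaleR filterlim_fst filterlim_snd)
next
  fix U :: "'a set"
  assume "open U" "0 \<in> U"
  then obtain e where "e > 0" "ball 0 e \<subseteq> U"
    by (meson open_contains_ball)
  then have "open (ball (0::'a) e) \<and> 0 \<in> ball (0::'a) e \<and> ball 0 e \<subseteq> U \<and> convex (ball (0::'a) e)"
    by simp
  then show "\<exists>V. open V \<and> 0 \<in> V \<and> V \<subseteq> U \<and>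
      (\<forall>x\<in>V. \<forall>y\<in>V. \<forall>u\<ge>0. \<forall>v\<ge>0. u + v = 1 \<longrightarrow> u *\<^sub>R x + v *\<^sub>R y \<in> V)"
    unfolding convex_def by blast
qed

definition Orb :: "'a \<Rightarrow> ('a \<Rightarrow> 'a) \<Rightarrow> 'a set" where
  "Orb x T = range (\<lambda>n. (T ^^ n) x)"

definition hypercyclic_vector :: "('a::topological_space \<Rightarrow> 'a) \<Rightarrow> 'a \<Rightarrow> bool" where
  "hypercyclic_vector T x \<longleftrightarrow> closure (Orb x T) = UNIV"

definition hypercyclic :: "('a::topological_space \<Rightarrow> 'a) \<Rightarrow> bool" where
  "hypercyclic T \<longleftrightarrow> (\<exists>x. hypercyclic_vector T x)"

end

theory Submission
  imports Defs "HOL-Computational_Algebra.Fundamental_Theorem_Algebra"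
begin

text \<open>
  Let \<open>x\<close> be a hypercyclic vector.  The subspace is \<open>M = {p(T) x}\<close>, with \<open>p\<close> ranging over the
  real polynomials.  It is invariant, and dense because it contains the orbit of \<open>x\<close>.  As \<open>p(T)\<close>
  commutes with \<open>T\<close>, it maps the orbit of \<open>x\<close> onto the orbit of \<open>p(T) x\<close>, so \<open>p(T) x\<close> is
  hypercyclic as soon as \<open>p(T)\<close> has dense range (\<open>dense_image\<close>).  Hence everything rests on
  \<open>dense_range_poly_op\<close>: \<open>p(T)\<close> has dense range for every \<open>p \<noteq> 0\<close>.

  Continuous maps with dense range compose, so it suffices to treat the irreducible factors
  \<open>t - a\<close> and \<open>(t - a)\<^sup>2 + b\<^sup>2\<close> of \<open>p\<close> (\<open>real_poly_factor\<close>).  If such a factor, evaluated at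
  \<open>T\<close>, had its range inside a proper closed subspace \<open>R\<close>, then modulo \<open>R\<close> the operator \<open>T\<close> would
  be multiplication by a scalar, real or complex.  Local convexity supplies a non-zero continuous
  seminorm vanishing on \<open>R\<close> (\<open>separating_seminorm\<close>); in the complex case one then takes its supremum
  over the complex unit disc.  The result is a non-zero continuous seminorm \<open>Q\<close> with \<open>Q (T v) = r * Q v\<close>
  for a constant \<open>r \<ge> 0\<close>.  Along an orbit \<open>Q\<close> is then the geometric sequence \<open>r ^ n * Q x\<close>, which
  is not dense in the half-line of values of \<open>Q\<close> (\<open>scaled_seminorm_trivial\<close>).
\<close>

section \<open>Dense range\<close>

lemma dense_iff_meets_open:
  fixes S :: "'a::topological_space set"
  shows "closure S = UNIV \<longleftrightarrow> (\<forall>U. open U \<and> U \<noteq> {} \<longrightarrow> U \<inter> S \<noteq> {})"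
proof
  assume "closure S = UNIV"
  then show "\<forall>U. open U \<and> U \<noteq> {} \<longrightarrow> U \<inter> S \<noteq> {}"
    by (metis Int_UNIV_right open_Int_closure_eq_empty)
next
  assume *: "\<forall>U. open U \<and> U \<noteq> {} \<longrightarrow> U \<inter> S \<noteq> {}"
  have "- closure S \<inter> S = {}"
    using closure_subset by blast
  then show "closure S = UNIV"
    using * open_Compl[OF closed_closure[of S]] by auto
qed

lemma dense_image:
  fixes f :: "'a::topological_space \<Rightarrow> 'b::topological_space"
  assumes "continuous_on UNIV f" "closure (range f) = UNIV" "closure D = UNIV"
  shows "closure (f ` D) = UNIV"
proof -
  have "f ` closure D \<subseteq> closure (f ` D)"
    using assms by (intro continuous_image_closure_subset) auto
  then have "closure (range f) \<subseteq> closure (f ` D)"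
    using assms(3) by (simp add: closure_minimal)
  then show ?thesis
    using assms(2) by auto
qed

section \<open>Continuous seminorms\<close>

lemma tendsto_scaleR_lcs:
  fixes x :: "'a::locally_convex_space"
  assumes "(f \<longlongrightarrow> c) F" "(g \<longlongrightarrow> x) F"
  shows "((\<lambda>t. f t *\<^sub>R g t) \<longlongrightarrow> c *\<^sub>R x) F"
proof -
  have "filterlim (\<lambda>t. (f t, g t)) (nhds c \<times>\<^sub>F nhds x) F"
    using assms by (intro filterlim_Pair)
  then show ?thesis
    using filterlim_compose[OF tendsto_scaleR_Pair] by fastforce
qed

lemma continuous_on_scaleR_lcs:
  fixes g :: "'b::topological_space \<Rightarrow> 'a::locally_convex_space"
  assumes "continuous_on S f" "continuous_on S g"
  shows "continuous_on S (\<lambda>t. f t *\<^sub>R g t)"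
  using assms unfolding continuous_on_def by (auto intro: tendsto_scaleR_lcs)

lemma closure_subspace_lcs:
  fixes S :: "'a::locally_convex_space set"
  assumes "subspace S"
  shows "subspace (closure S)"
proof (rule subspaceI)
  show "0 \<in> closure S"
    using subspace_0[OF assms] closure_subset by blast
next
  have translate: "x + y \<in> closure S" if "x \<in> S" "y \<in> closure S" for x y
  proof -
    have "(\<lambda>y. x + y) ` closure S \<subseteq> closure S"
      using subspace_add[OF assms that(1)] closure_subset
      by (intro image_closure_subset) (auto intro!: continuous_intros)
    then show ?thesis
      using that by auto
  qed
  fix x y assume "x \<in> closure S" "y \<in> closure S"
  have "(\<lambda>x. x + y) ` closure S \<subseteq> closure S"
    using translate[OF _ \<open>y \<in> closure S\<close>]
    by (intro image_closure_subset) (auto intro!: continuous_intros)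
  then show "x + y \<in> closure S"
    using \<open>x \<in> closure S\<close> by auto
next
  fix c :: real and x assume "x \<in> closure S"
  have "(\<lambda>x. c *\<^sub>R x) ` closure S \<subseteq> closure S"
    using subspace_scale[OF assms] closure_subset
    by (intro image_closure_subset) (auto intro!: continuous_on_scaleR_lcs continuous_on_id)
  then show "c *\<^sub>R x \<in> closure S"
    using \<open>x \<in> closure S\<close> by auto
qed

definition is_seminorm :: "('a::real_vector \<Rightarrow> real) \<Rightarrow> bool" where
  "is_seminorm q \<longleftrightarrow> (\<forall>x y. q (x + y) \<le> q x + q y) \<and> (\<forall>c x. q (c *\<^sub>R x) = \<bar>c\<bar> * q x)"

lemma seminorm_triangle: "is_seminorm q \<Longrightarrow> q (x + y) \<le> q x + q y"
  and seminorm_scaleR: "is_seminorm q \<Longrightarrow> q (c *\<^sub>R x) = \<bar>c\<bar> * q x"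
  by (auto simp: is_seminorm_def)

lemma seminorm_0: "is_seminorm q \<Longrightarrow> q 0 = 0"
  using seminorm_scaleR[of q 0 0] by simp

lemma seminorm_minus: "is_seminorm q \<Longrightarrow> q (- x) = q x"
  using seminorm_scaleR[of q "-1" x] by simp

lemma seminorm_nonneg: "is_seminorm q \<Longrightarrow> 0 \<le> q x"
  using seminorm_triangle[of q x "- x"] by (simp add: seminorm_0 seminorm_minus)

lemma seminorm_diff: "is_seminorm q \<Longrightarrow> \<bar>q x - q y\<bar> \<le> q (x - y)"
  using seminorm_triangle[of q "x - y" y] seminorm_triangle[of q "y - x" x]
    seminorm_minus[of q "x - y"] by simp

lemma seminorm_cong_mod:
  assumes "is_seminorm q" "q (x - y) = 0"
  shows "q x = q y"
  using seminorm_diff[OF assms(1), of x y] assms(2) by simp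

lemma is_seminormI:
  assumes add: "\<And>x y. q (x + y) \<le> q x + q y" and zero: "q 0 = 0"
    and scale: "\<And>c x. c \<noteq> 0 \<Longrightarrow> q (c *\<^sub>R x) \<le> \<bar>c\<bar> * q x"
  shows "is_seminorm q"
proof -
  have "q (c *\<^sub>R x) = \<bar>c\<bar> * q x" for c x
  proof (cases "c = 0")
    case True
    then show ?thesis
      by (simp add: zero)
  next
    case False
    have "q x \<le> \<bar>inverse c\<bar> * q (c *\<^sub>R x)"
      using scale[of "inverse c" "c *\<^sub>R x"] False by simp
    then have "\<bar>c\<bar> * q x \<le> q (c *\<^sub>R x)"
      using False by (simp add: field_simps)
    then show ?thesis
      using scale[OF False, of x] by simp
  qed
  then show ?thesis
    using add by (simp add: is_seminorm_def)
qed

lemma continuous_on_seminorm: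
  fixes q :: "'a::locally_convex_space \<Rightarrow> real"
  assumes q: "is_seminorm q"
    and small: "\<And>e. e > 0 \<Longrightarrow> \<exists>V. open V \<and> 0 \<in> V \<and> (\<forall>v\<in>V. q v < e)"
  shows "continuous_on UNIV q"
proof -
  have "(q \<longlongrightarrow> q x) (at x)" for x
  proof (rule tendstoI)
    fix e :: real assume "e > 0"
    then obtain V where V: "open V" "0 \<in> V" "\<forall>v\<in>V. q v < e"
      using small by blast
    have "open ((\<lambda>y. y - x) -` V)"
      by (intro open_vimage V(1) continuous_intros)
    then have "\<forall>\<^sub>F y in at x. y - x \<in> V"
      unfolding eventually_at_topological using V(2)
      by (intro exI[of _ "(\<lambda>y. y - x) -` V"]) auto
    then show "\<forall>\<^sub>F y in at x. dist (q y) (q x) < e"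
    proof eventually_elim
      case (elim y)
      then show ?case
        using V(3) seminorm_diff[OF q, of y x] by (force simp: dist_real_def)
    qed
  qed
  then show ?thesis
    by (simp add: continuous_on_def)
qed

definition minkowski_fn :: "'a::real_vector set \<Rightarrow> 'a \<Rightarrow> real" where
  "minkowski_fn U v = Inf {t. t > 0 \<and> v \<in> (*\<^sub>R) t ` U}"

lemma convex_scaling_mono:
  fixes U :: "'a::real_vector set"
  assumes U: "convex U" "0 \<in> U" and v: "v \<in> (*\<^sub>R) t ` U" and "0 < t" "t \<le> s"
  shows "v \<in> (*\<^sub>R) s ` U"
proof -
  obtain u where u: "u \<in> U" "v = t *\<^sub>R u"
    using v by auto
  have "(t / s) *\<^sub>R u + (1 - t / s) *\<^sub>R 0 \<in> U"
    using assms u by (intro convexD) auto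
  then show ?thesis
    using assms u by (intro image_eqI[of _ _ "(t / s) *\<^sub>R u"]) auto
qed

lemma is_seminorm_minkowski_fn:
  fixes U :: "'a::real_vector set"
  assumes U: "convex U" "0 \<in> U" and sym: "\<And>u. u \<in> U \<Longrightarrow> - u \<in> U"
    and absorb: "\<And>v. \<exists>t>0. v \<in> (*\<^sub>R) t ` U"
  shows "is_seminorm (minkowski_fn U)"
proof -
  let ?A = "\<lambda>v. {t. t > 0 \<and> v \<in> (*\<^sub>R) t ` U}"
  have ne: "?A v \<noteq> {}" for v
    using absorb[of v] by auto
  have bdd: "bdd_below (?A v)" for v
    by (intro bdd_belowI[of _ 0]) auto
  have approx: "\<exists>t \<in> ?A v. t < minkowski_fn U v + e" if "e > 0" for v e
    using cInf_lessD[OF ne[of v], of "minkowski_fn U v + e"] that by (auto simp: minkowski_fn_def)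
  have lower: "minkowski_fn U v \<le> t" if "t \<in> ?A v" for t v
    unfolding minkowski_fn_def using that bdd by (rule cInf_lower)
  have nonneg: "0 \<le> minkowski_fn U v" for v
    unfolding minkowski_fn_def by (rule cInf_greatest[OF ne]) auto
  show ?thesis
  proof (rule is_seminormI)
    fix x y
    show "minkowski_fn U (x + y) \<le> minkowski_fn U x + minkowski_fn U y"
    proof (rule field_le_epsilon)
      fix e :: real assume "e > 0"
      then have "e / 2 > 0"
        by simp
      then obtain s t where s: "s \<in> ?A x" "s < minkowski_fn U x + e / 2"
        and t: "t \<in> ?A y" "t < minkowski_fn U y + e / 2"
        using approx by blast
      obtain u v where u: "u \<in> U" "x = s *\<^sub>R u" and v: "v \<in> U" "y = t *\<^sub>R v"
        using s t by auto
      have st: "s > 0" "t > 0"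
        using s t by auto
      have "(s / (s + t)) *\<^sub>R u + (t / (s + t)) *\<^sub>R v \<in> U"
        using st by (intro convexD U u v) (auto simp flip: add_divide_distrib)
      moreover have "x + y = (s + t) *\<^sub>R ((s / (s + t)) *\<^sub>R u + (t / (s + t)) *\<^sub>R v)"
        using st by (simp add: u v scaleR_add_right)
      ultimately have "s + t \<in> ?A (x + y)"
        using st by auto
      then show "minkowski_fn U (x + y) \<le> minkowski_fn U x + minkowski_fn U y + e"
        using lower[of "s + t" "x + y"] s t by linarith
    qed
  next
    have "minkowski_fn U 0 \<le> 0"
    proof (rule field_le_epsilon)
      fix e :: real assume "e > 0"
      then have "e \<in> ?A 0"
        using U(2) by (auto intro!: image_eqI[of _ _ 0])
      then show "minkowski_fn U 0 \<le> 0 + e"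
        using lower[of e 0] by simp
    qed
    then show "minkowski_fn U 0 = 0"
      using nonneg[of 0] by simp
  next
    fix c :: real and x assume c: "c \<noteq> 0"
    show "minkowski_fn U (c *\<^sub>R x) \<le> \<bar>c\<bar> * minkowski_fn U x"
    proof (rule field_le_epsilon)
      fix e :: real assume "e > 0"
      then have "e / \<bar>c\<bar> > 0"
        using c by simp
      then obtain t where t: "t \<in> ?A x" "t < minkowski_fn U x + e / \<bar>c\<bar>"
        using approx by blast
      obtain u where u: "u \<in> U" "x = t *\<^sub>R u"
        using t by auto
      have "\<exists>w\<in>U. c *\<^sub>R x = (\<bar>c\<bar> * t) *\<^sub>R w"
        using u sym[OF u(1)] by (cases "c > 0") (auto intro: bexI[of _ u] bexI[of _ "- u"])
      then have "\<bar>c\<bar> * t \<in> ?A (c *\<^sub>R x)"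
        using t c by auto
      then have "minkowski_fn U (c *\<^sub>R x) \<le> \<bar>c\<bar> * t"
        by (rule lower)
      also have "\<dots> \<le> \<bar>c\<bar> * (minkowski_fn U x + e / \<bar>c\<bar>)"
        using t by (intro mult_left_mono) auto
      also have "\<dots> = \<bar>c\<bar> * minkowski_fn U x + e"
        using c by (simp add: field_simps)
      finally show "minkowski_fn U (c *\<^sub>R x) \<le> \<bar>c\<bar> * minkowski_fn U x + e" .
    qed
  qed
qed

text \<open>
  A convex symmetric neighbourhood \<open>W\<close> of \<open>0\<close> so small that \<open>z + W\<close> misses \<open>R\<close> gives the Minkowski
  functional of \<open>W + R\<close>: it vanishes on \<open>R\<close> because all multiples of \<open>R\<close> lie in \<open>W + R\<close>, it is
  continuous because \<open>W \<subseteq> W + R\<close>, and it is at least \<open>1\<close> at \<open>z\<close> because \<open>z \<notin> W + R\<close>.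
\<close>

lemma separating_seminorm:
  fixes R :: "'a::locally_convex_space set"
  assumes R: "subspace R" "closed R" and z: "z \<notin> R"
  shows "\<exists>q. is_seminorm q \<and> continuous_on UNIV q \<and> (\<forall>r\<in>R. q r = 0) \<and> q z \<noteq> 0"
proof -
  have "open ((\<lambda>v. z + v) -` (- R))"
    using R(2) by (intro open_vimage continuous_intros) auto
  then obtain V where V: "open V" "0 \<in> V" "V \<subseteq> (\<lambda>v. z + v) -` (- R)" "convex V"
    using locally_convex[of "(\<lambda>v. z + v) -` (- R)"] z by auto
  define W where "W = V \<inter> uminus -` V"
  have "open (uminus -` V)"
    using V(1) by (intro open_vimage continuous_intros) auto
  then have W: "open W" "0 \<in> W" "\<And>w. w \<in> W \<Longrightarrow> - w \<in> W"
    using V by (auto simp: W_def)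
  have "convex (uminus -` V)"
    using V(4) by (intro convex_linear_vimage) (auto simp: linear_iff)
  then have "convex W"
    using V(4) by (auto simp: W_def intro: convex_Int)
  define U where "U = {w + r | w r. w \<in> W \<and> r \<in> R}"
  have W_U: "W \<subseteq> U" and R_U: "R \<subseteq> U"
    using subspace_0[OF R(1)] W(2) unfolding U_def by force+
  have "U = (\<Union>w\<in>W. \<Union>r\<in>R. {w + r})"
    by (auto simp: U_def)
  then have cU: "convex U"
    using convex_sums[OF \<open>convex W\<close> subspace_imp_convex[OF R(1)]] by simp
  have symU: "- u \<in> U" if u: "u \<in> U" for u
  proof -
    obtain w r where "w \<in> W" "r \<in> R" "u = w + r"
      using u by (auto simp: U_def)
    then have "- u = - w + - r" "- w \<in> W" "- r \<in> R"
      using W(3) subspace_neg[OF R(1)] by auto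
    then show ?thesis
      unfolding U_def by blast
  qed
  have zU: "z \<notin> U"
  proof
    assume "z \<in> U"
    then obtain w r where "w \<in> W" "r \<in> R" "z = w + r"
      by (auto simp: U_def)
    then have "- w \<in> V" "z + (- w) \<in> R"
      by (auto simp: W_def)
    then show False
      using V(3) by auto
  qed
  have absorb: "\<exists>t>0. v \<in> (*\<^sub>R) t ` U" for v
  proof -
    have "((\<lambda>t. inverse t *\<^sub>R v) \<longlongrightarrow> 0 *\<^sub>R v) at_top"
      by (intro tendsto_scaleR_lcs tendsto_inverse_0_at_top filterlim_ident tendsto_const)
    then have "\<forall>\<^sub>F t::real in at_top. inverse t *\<^sub>R v \<in> W"
      using W by (auto simp: tendsto_def)
    then have "\<forall>\<^sub>F t::real in at_top. inverse t *\<^sub>R v \<in> W \<and> t > 0"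
      using eventually_gt_at_top eventually_conj by blast
    then obtain t :: real where t: "inverse t *\<^sub>R v \<in> W" "t > 0"
      using eventually_happens by fastforce
    then show ?thesis
      using W_U by (intro exI[of _ t]) (auto intro!: image_eqI[of _ _ "inverse t *\<^sub>R v"])
  qed
  have U0: "0 \<in> U"
    using W(2) W_U by auto
  have sn: "is_seminorm (minkowski_fn U)"
    by (intro is_seminorm_minkowski_fn cU U0 symU absorb)
  have lower: "minkowski_fn U v \<le> t" if "t > 0" "v \<in> (*\<^sub>R) t ` U" for v t
    unfolding minkowski_fn_def using that by (intro cInf_lower bdd_belowI[of _ 0]) auto
  show ?thesis
  proof (intro exI[of _ "minkowski_fn U"] conjI ballI)
    show "is_seminorm (minkowski_fn U)"
      by (fact sn)
    show "continuous_on UNIV (minkowski_fn U)"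
    proof (rule continuous_on_seminorm[OF sn])
      fix e :: real assume "e > 0"
      have "open ((\<lambda>v. (2 / e) *\<^sub>R v) -` W)"
        using W(1) by (intro open_vimage continuous_on_scaleR_lcs continuous_intros) auto
      moreover have "minkowski_fn U v < e" if v: "(2 / e) *\<^sub>R v \<in> W" for v
      proof -
        have "v \<in> (*\<^sub>R) (e / 2) ` U"
          using v W_U \<open>e > 0\<close> by (intro image_eqI[of _ _ "(2 / e) *\<^sub>R v"]) auto
        then show ?thesis
          using lower[of "e / 2" v] \<open>e > 0\<close> by simp
      qed
      ultimately show "\<exists>V. open V \<and> 0 \<in> V \<and> (\<forall>v\<in>V. minkowski_fn U v < e)"
        using W(2) by (intro exI[of _ "(\<lambda>v. (2 / e) *\<^sub>R v) -` W"]) auto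
    qed
    fix r assume r: "r \<in> R"
    show "minkowski_fn U r = 0"
    proof -
      have "minkowski_fn U r \<le> 0"
      proof (rule field_le_epsilon)
        fix e :: real assume "e > 0"
        have "r \<in> (*\<^sub>R) e ` U"
          using subspace_scale[OF R(1) r, of "inverse e"] R_U \<open>e > 0\<close>
          by (intro image_eqI[of _ _ "inverse e *\<^sub>R r"]) auto
        then show "minkowski_fn U r \<le> 0 + e"
          using lower[of e r] \<open>e > 0\<close> by simp
      qed
      then show ?thesis
        using seminorm_nonneg[OF sn, of r] by simp
    qed
  next
    have "1 \<le> minkowski_fn U z"
      unfolding minkowski_fn_def
    proof (rule cInf_greatest)
      show "{t. t > 0 \<and> z \<in> (*\<^sub>R) t ` U} \<noteq> {}"
        using absorb[of z] by auto
      fix t assume t: "t \<in> {t. t > 0 \<and> z \<in> (*\<^sub>R) t ` U}"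
      show "1 \<le> t"
      proof (rule ccontr)
        assume "\<not> 1 \<le> t"
        then have "z \<in> (*\<^sub>R) 1 ` U"
          using t convex_scaling_mono[OF cU U0, of z t 1] by simp
        then show False
          using zU by auto
      qed
    qed
    then show "minkowski_fn U z \<noteq> 0"
      by linarith
  qed
qed

section \<open>Hypercyclic operators have no scaled seminorms\<close>

text \<open>
  A non-zero \<open>Q\<close> takes all values in the half-line of non-negative reals, and by density the
  values along the orbit of a hypercyclic \<open>x\<close> come close to all of them.  But these values are
  \<open>r ^ n * Q x\<close>, which never exceed \<open>Q x\<close> if \<open>r \<le> 1\<close> and never drop below it if \<open>r > 1\<close>.
\<close>

lemma scaled_seminorm_trivial:
  fixes T :: "'a::locally_convex_space \<Rightarrow> 'a"
  assumes hyp: "hypercyclic T" and Q: "is_seminorm Q" "continuous_on UNIV Q"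
    and scaled: "\<And>v. Q (T v) = r * Q v" and r: "0 \<le> r"
  shows "Q z = 0"
proof (rule ccontr)
  assume "Q z \<noteq> 0"
  then have "Q z > 0"
    using seminorm_nonneg[OF Q(1), of z] by simp
  obtain x where "closure (Orb x T) = UNIV"
    using hyp by (auto simp: hypercyclic_def hypercyclic_vector_def)
  then have dense: "\<exists>n. (T ^^ n) x \<in> U" if "open U" "u \<in> U" for U u
    using that unfolding dense_iff_meets_open Orb_def by blast
  have pow: "Q ((T ^^ n) x) = r ^ n * Q x" for n
    by (induction n) (simp_all add: scaled)
  have Qx: "Q x \<ge> 0"
    by (rule seminorm_nonneg[OF Q(1)])
  have above: "\<exists>n. s < r ^ n * Q x" if "s \<ge> 0" for s
  proof -
    have "open (Q -` {s<..})"
      using Q(2) by (intro open_vimage) auto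
    moreover have "((s + 1) / Q z) *\<^sub>R z \<in> Q -` {s<..}"
      using \<open>Q z > 0\<close> that by (simp add: seminorm_scaleR[OF Q(1)])
    ultimately show ?thesis
      using dense by (force simp: pow)
  qed
  show False
  proof (cases "r \<le> 1")
    case True
    then have "r ^ n * Q x \<le> 1 * Q x" for n
      using r Qx by (intro mult_right_mono power_le_one)
    then show False
      using above[OF Qx] by (metis linorder_not_le mult_1)
  next
    case False
    have "Q x \<noteq> 0"
      using above[of 0] by auto
    then have "Q x > 0"
      using Qx by simp
    have "open (Q -` {..<Q x})"
      using Q(2) by (intro open_vimage) auto
    moreover have "0 \<in> Q -` {..<Q x}"
      using \<open>Q x > 0\<close> by (simp add: seminorm_0[OF Q(1)])
    ultimately obtain n where "r ^ n * Q x < Q x"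
      using dense by (force simp: pow)
    moreover have "1 * Q x \<le> r ^ n * Q x"
      using False Qx by (intro mult_right_mono one_le_power) auto
    ultimately show False
      by simp
  qed
qed

section \<open>Linear and quadratic polynomials in a hypercyclic operator\<close>

lemma nondense_range_seminorm:
  fixes A :: "'a::locally_convex_space \<Rightarrow> 'a"
  assumes "linear A" "closure (range A) \<noteq> UNIV"
  shows "\<exists>q z. is_seminorm q \<and> continuous_on UNIV q \<and> (\<forall>v. q (A v) = 0) \<and> q z \<noteq> 0"
proof -
  obtain z where z: "z \<notin> closure (range A)"
    using assms(2) by auto
  have "subspace (closure (range A))"
    using linear_subspace_image[OF assms(1) subspace_UNIV] by (rule closure_subspace_lcs)
  from separating_seminorm[OF this closed_closure z] obtain q where q: "is_seminorm q"
    "continuous_on UNIV q" "\<forall>r\<in>closure (range A). q r = 0" "q z \<noteq> 0"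
    by blast
  moreover have "A v \<in> closure (range A)" for v
    using closure_subset[of "range A"] by blast
  ultimately show ?thesis
    by blast
qed

text \<open>
  Otherwise a seminorm vanishing on the range of \<open>T - a\<close> cannot tell \<open>T v\<close> from \<open>a *\<^sub>R v\<close>, and is
  therefore scaled by \<open>\<bar>a\<bar>\<close> under \<open>T\<close>.
\<close>

lemma dense_range_linear_factor:
  fixes T :: "'a::locally_convex_space \<Rightarrow> 'a"
  assumes T: "linear T" and hyp: "hypercyclic T"
  shows "closure (range (\<lambda>v. T v - a *\<^sub>R v)) = UNIV"
proof (rule ccontr)
  assume "\<not> ?thesis"
  have "linear (\<lambda>v. T v - a *\<^sub>R v)"
    using T by (simp add: linear_iff algebra_simps)
  from nondense_range_seminorm[OF this \<open>\<not> ?thesis\<close>] obtain q z where q: "is_seminorm q" "continuous_on UNIV q"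
    "\<And>v. q (T v - a *\<^sub>R v) = 0" and z: "q z \<noteq> 0"
    by blast
  have "q (T v) = \<bar>a\<bar> * q v" for v
    using seminorm_cong_mod[OF q(1,3)] by (simp add: seminorm_scaleR[OF q(1)])
  then have "q z = 0"
    by (intro scaled_seminorm_trivial[OF hyp q(1,2)]) auto
  then show False
    using z by simp
qed

text \<open>
  Modulo the closure of the range, \<open>J = (T - a) / b\<close> satisfies \<open>J\<^sup>2 = -1\<close>.  So \<open>J\<close> acts as the
  imaginary unit, and \<open>T = a + b J\<close> acts as multiplication by the complex number \<open>l = a + b \<i>\<close>.
  The seminorm \<open>q\<close> at hand is only real homogeneous; the supremum of \<open>q (w v)\<close> over the complex
  unit disc makes it complex homogeneous, hence scaled by \<open>\<bar>l\<bar>\<close> under \<open>T\<close>.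
\<close>

lemma dense_range_quadratic_factor:
  fixes T :: "'a::locally_convex_space \<Rightarrow> 'a"
  assumes T: "linear T" "continuous_on UNIV T" and hyp: "hypercyclic T" and b: "b \<noteq> 0"
  shows "closure (range (\<lambda>v. T (T v) - (2 * a) *\<^sub>R T v + (a\<^sup>2 + b\<^sup>2) *\<^sub>R v)) = UNIV"
    (is "closure (range ?A) = UNIV")
proof (rule ccontr)
  assume "\<not> ?thesis"
  have "linear ?A"
    using T(1) by (simp add: linear_iff algebra_simps)
  from nondense_range_seminorm[OF this \<open>\<not> ?thesis\<close>] obtain q z where q: "is_seminorm q" "continuous_on UNIV q"
    "\<And>v. q (?A v) = 0" and z: "q z \<noteq> 0"
    by blast
  define J where "J v = (1 / b) *\<^sub>R (T v - a *\<^sub>R v)" for v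
  have J: "linear J"
    using T(1) by (simp add: linear_iff J_def algebra_simps)
  have cJ: "continuous_on UNIV J"
    unfolding J_def by (intro continuous_on_scaleR_lcs continuous_intros T)
  have TJ: "T v = a *\<^sub>R v + b *\<^sub>R J v" for v
    using b by (simp add: J_def)
  have JJ: "J (J v) + v = (1 / b\<^sup>2) *\<^sub>R ?A v" for v
  proof -
    have bJ: "b *\<^sub>R J u = T u - a *\<^sub>R u" for u
      by (simp add: TJ)
    have "b\<^sup>2 *\<^sub>R J (J v) = b *\<^sub>R (T (J v) - a *\<^sub>R J v)"
      by (simp add: power2_eq_square flip: bJ)
    also have "\<dots> = T (b *\<^sub>R J v) - a *\<^sub>R (b *\<^sub>R J v)"
      by (simp add: linear_scale[OF T(1)] algebra_simps)
    also have "\<dots> = ?A v - b\<^sup>2 *\<^sub>R v"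
      unfolding bJ
      by (simp add: linear_diff[OF T(1)] linear_scale[OF T(1)] power2_eq_square algebra_simps
          flip: scaleR_2)
    finally have "?A v = b\<^sup>2 *\<^sub>R (J (J v) + v)"
      by (simp add: scaleR_add_right)
    then show ?thesis
      using b by simp
  qed
  \<comment> \<open>\<open>N w v\<close> is \<open>q\<close> at the complex multiple \<open>w v\<close>, with \<open>J\<close> in the role of the imaginary unit.\<close>
  define N where "N w v = q (Re w *\<^sub>R v + Im w *\<^sub>R J v)" for w v
  define l where "l = Complex a b"
  have l: "l \<noteq> 0"
    using b by (simp add: l_def complex_eq_iff)
  have N_T: "N w (T v) = N (w * l) v" for w v
  proof -
    have JT: "J (T v) = a *\<^sub>R J v + b *\<^sub>R J (J v)"
      using J by (simp add: TJ linear_add linear_scale)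
    have "Re w *\<^sub>R T v + Im w *\<^sub>R J (T v)
        - (Re (w * l) *\<^sub>R v + Im (w * l) *\<^sub>R J v) = (Im w * b) *\<^sub>R (J (J v) + v)"
      unfolding JT by (simp add: TJ l_def algebra_simps)
    then have "Re w *\<^sub>R T v + Im w *\<^sub>R J (T v)
        - (Re (w * l) *\<^sub>R v + Im (w * l) *\<^sub>R J v) = (Im w * b * (1 / b\<^sup>2)) *\<^sub>R ?A v"
      by (simp only: JJ scaleR_scaleR)
    then show ?thesis
      unfolding N_def using seminorm_cong_mod[OF q(1)] by (metis mult_zero_right q(3) seminorm_scaleR[OF q(1)])
  qed
  have N_scale: "N (of_real c * w) v = \<bar>c\<bar> * N w v" for c w v
    using seminorm_scaleR[OF q(1), of c "Re w *\<^sub>R v + Im w *\<^sub>R J v"]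
    by (simp add: N_def scaleR_add_right)
  have N_le: "N w v \<le> q v + q (J v)" if "cmod w \<le> 1" for w v
  proof -
    have "N w v \<le> \<bar>Re w\<bar> * q v + \<bar>Im w\<bar> * q (J v)"
      unfolding N_def using seminorm_triangle[OF q(1)] by (metis seminorm_scaleR[OF q(1)])
    also have "\<dots> \<le> 1 * q v + 1 * q (J v)"
      using that abs_Re_le_cmod[of w] abs_Im_le_cmod[of w]
      by (intro add_mono mult_right_mono seminorm_nonneg[OF q(1)]) auto
    finally show ?thesis
      by simp
  qed
  define Q where "Q v = (SUP w\<in>cball 0 1. N w v)" for v
  have bdd: "bdd_above ((\<lambda>w. N w v) ` cball 0 1)" for v
    using N_le by (intro bdd_aboveI2[of _ _ "q v + q (J v)"]) auto
  have N_Q: "N w v \<le> Q v" if "cmod w \<le> 1" for w v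
    unfolding Q_def using that by (intro cSUP_upper bdd) auto
  have Q_le: "Q v \<le> B" if "\<And>w. cmod w \<le> 1 \<Longrightarrow> N w v \<le> B" for v B
    unfolding Q_def using that by (intro cSUP_least) auto
  have N_bound: "N w v \<le> cmod w * Q v" for w v
  proof -
    have "w = of_real (cmod w) * sgn w"
      by (cases "w = 0") (simp_all add: sgn_eq)
    then have "N w v = cmod w * N (sgn w) v"
      using N_scale[of "cmod w" "sgn w" v] by simp
    also have "\<dots> \<le> cmod w * Q v"
      by (intro mult_left_mono N_Q) (auto simp: norm_sgn)
    finally show ?thesis .
  qed
  have Q: "is_seminorm Q"
  proof (rule is_seminormI)
    fix x y
    show "Q (x + y) \<le> Q x + Q y"
    proof (rule Q_le)
      fix w :: complex assume w: "cmod w \<le> 1"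
      have "N w (x + y) \<le> N w x + N w y"
        using seminorm_triangle[OF q(1), of "Re w *\<^sub>R x + Im w *\<^sub>R J x"
            "Re w *\<^sub>R y + Im w *\<^sub>R J y"]
        by (simp add: N_def linear_add[OF J] algebra_simps)
      then show "N w (x + y) \<le> Q x + Q y"
        using N_Q[OF w, of x] N_Q[OF w, of y] by linarith
    qed
  next
    have "N w 0 = 0" for w
      by (simp add: N_def linear_0[OF J] seminorm_0[OF q(1)])
    then show "Q 0 = 0"
      by (simp add: Q_def)
  next
    fix c x
    show "Q (c *\<^sub>R x) \<le> \<bar>c\<bar> * Q x"
    proof (rule Q_le)
      fix w :: complex assume w: "cmod w \<le> 1"
      have "N w (c *\<^sub>R x) = N (of_real c * w) x"
        by (simp add: N_def linear_scale[OF J] mult.commute)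
      also have "\<dots> \<le> \<bar>c\<bar> * Q x"
        by (simp add: N_scale N_Q[OF w] mult_left_mono)
      finally show "N w (c *\<^sub>R x) \<le> \<bar>c\<bar> * Q x" .
    qed
  qed
  have "continuous_on UNIV Q"
  proof (rule continuous_on_seminorm[OF Q])
    fix e :: real assume "e > 0"
    let ?V = "(\<lambda>v. q v + q (J v)) -` {..<e}"
    have "continuous_on UNIV (\<lambda>v. q v + q (J v))"
      using continuous_on_compose[OF cJ continuous_on_subset[OF q(2)]]
      by (intro continuous_on_add q(2)) (auto simp: o_def)
    then have "open ?V"
      by (intro open_vimage) auto
    moreover have "0 \<in> ?V"
      using \<open>e > 0\<close> by (simp add: seminorm_0[OF q(1)] linear_0[OF J])
    moreover have "Q v < e" if "v \<in> ?V" for v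
      using that Q_le[of v "q v + q (J v)", OF N_le] by simp
    ultimately show "\<exists>V. open V \<and> 0 \<in> V \<and> (\<forall>v\<in>V. Q v < e)"
      by blast
  qed
  moreover have "Q (T v) = cmod l * Q v" for v
  proof (rule antisym)
    show "Q (T v) \<le> cmod l * Q v"
    proof (rule Q_le)
      fix w :: complex assume w: "cmod w \<le> 1"
      have "N w (T v) \<le> cmod (w * l) * Q v"
        using N_bound[of "w * l" v] by (simp add: N_T)
      also have "\<dots> \<le> cmod l * Q v"
        using w by (intro mult_right_mono seminorm_nonneg[OF Q])
          (auto simp: norm_mult mult_left_le_one_le)
      finally show "N w (T v) \<le> cmod l * Q v" .
    qed
    have "Q v \<le> Q (T v) / cmod l"
    proof (rule Q_le)
      fix w :: complex assume w: "cmod w \<le> 1"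
      have "N w v = N (w / l) (T v)"
        using l by (simp add: N_T)
      also have "\<dots> \<le> cmod (w / l) * Q (T v)"
        by (rule N_bound)
      also have "\<dots> \<le> Q (T v) / cmod l"
        using w l mult_right_mono[OF w seminorm_nonneg[OF Q, of "T v"]]
        by (simp add: norm_divide divide_simps)
      finally show "N w v \<le> Q (T v) / cmod l" .
    qed
    then show "cmod l * Q v \<le> Q (T v)"
      using l by (simp add: field_simps)
  qed
  ultimately have "Q z = 0"
    by (intro scaled_seminorm_trivial[OF hyp Q]) auto
  moreover have "q z \<le> Q z"
    using N_Q[of 1 z] by (simp add: N_def)
  ultimately show False
    using z seminorm_nonneg[OF q(1), of z] by simp
qed

section \<open>Polynomials in an operator\<close>

text \<open>
  The same recursion scheme as for \<^const>\<open>poly\<close>, with multiplication by the argument replaced by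
  application of \<open>T\<close>, so that \<open>p(T)\<close> can be handled by induction on \<open>p\<close>.
\<close>

definition poly_op :: "('a::real_vector \<Rightarrow> 'a) \<Rightarrow> real poly \<Rightarrow> 'a \<Rightarrow> 'a" where
  "poly_op T p = fold_coeffs (\<lambda>a f v. a *\<^sub>R v + T (f v)) p (\<lambda>v. 0)"

context
  fixes T :: "'a::real_vector \<Rightarrow> 'a"
  assumes T: "linear T"
begin

lemma poly_op_0: "poly_op T 0 v = 0"
  by (simp add: poly_op_def)

lemma poly_op_pCons: "poly_op T (pCons a p) v = a *\<^sub>R v + T (poly_op T p v)"
  by (cases "p = 0 \<and> a = 0") (auto simp: poly_op_def linear_0[OF T])

lemma poly_op_add: "poly_op T (p + q) v = poly_op T p v + poly_op T q v"
  by (induction p q rule: poly_induct2)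
    (simp_all add: poly_op_0 poly_op_pCons linear_add[OF T] algebra_simps)

lemma poly_op_smult: "poly_op T (smult c p) v = c *\<^sub>R poly_op T p v"
  by (induction p) (simp_all add: poly_op_0 poly_op_pCons linear_scale[OF T] algebra_simps)

lemma poly_op_mult: "poly_op T (p * q) v = poly_op T p (poly_op T q v)"
  by (induction p)
    (simp_all add: poly_op_0 poly_op_pCons poly_op_add poly_op_smult)

lemma poly_op_monom: "poly_op T (monom 1 n) v = (T ^^ n) v"
  by (induction n) (simp_all add: monom_0 monom_Suc poly_op_0 poly_op_pCons linear_0[OF T])

lemma poly_op_commute: "poly_op T p (T v) = T (poly_op T p v)"
  by (induction p)
    (simp_all add: poly_op_0 poly_op_pCons linear_0[OF T] linear_add[OF T] linear_scale[OF T])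

lemma Orb_poly_op: "Orb (poly_op T p x) T = poly_op T p ` Orb x T"
proof -
  have "(T ^^ n) (poly_op T p x) = poly_op T p ((T ^^ n) x)" for n
    by (induction n) (simp_all add: poly_op_commute)
  then show ?thesis
    by (auto simp: Orb_def)
qed

end

lemma continuous_on_poly_op:
  fixes T :: "'a::locally_convex_space \<Rightarrow> 'a"
  assumes "linear T" "continuous_on UNIV T"
  shows "continuous_on UNIV (poly_op T p)"
proof (induction p)
  case 0
  show ?case
    by (simp add: poly_op_def)
next
  case (pCons a p)
  have "continuous_on UNIV (\<lambda>v. a *\<^sub>R v + T (poly_op T p v))"
    using continuous_on_compose[OF pCons(2) continuous_on_subset[OF assms(2)]]
    by (intro continuous_on_add continuous_on_scaleR_lcs continuous_intros) (auto simp: o_def)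
  then show ?case
    by (subst ext[OF poly_op_pCons[OF assms(1)]])
qed

section \<open>Irreducible factors of real polynomials\<close>

lemma poly_of_real_add:
  "poly (map_poly complex_of_real (p + q)) z
    = poly (map_poly of_real p) z + poly (map_poly of_real q) z"
  by (induction p q rule: poly_induct2) (simp_all add: map_poly_pCons algebra_simps)

lemma poly_of_real_mult:
  "poly (map_poly complex_of_real (p * q)) z
    = poly (map_poly of_real p) z * poly (map_poly of_real q) z"
proof (induction p)
  case 0
  then show ?case
    by simp
next
  case (pCons a p)
  have "poly (map_poly complex_of_real (smult a q)) z = of_real a * poly (map_poly of_real q) z"
    by (simp add: map_poly_smult)
  then show ?case
    using pCons by (simp add: poly_of_real_add map_poly_pCons algebra_simps)
qed

text \<open>
  A complex root \<open>z\<close> of \<open>p\<close> yields the factor.  If \<open>z\<close> is not real, the remainder of \<open>p\<close> modulo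
  \<open>(t - Re z)\<^sup>2 + (Im z)\<^sup>2\<close> is a real polynomial of degree at most \<open>1\<close> with the non-real root \<open>z\<close>,
  hence zero.
\<close>

lemma real_poly_factor:
  fixes p :: "real poly"
  assumes "degree p > 0"
  obtains a q where "p = [:- a, 1:] * q"
    | a b q where "b \<noteq> 0" "p = [:a\<^sup>2 + b\<^sup>2, - 2 * a, 1:] * q"
proof -
  let ?C = "\<lambda>p. map_poly complex_of_real p"
  have "degree (?C p) > 0"
    using assms by (simp add: degree_map_poly)
  then have "\<exists>z. poly (?C p) z = 0"
    by (intro fundamental_theorem_of_algebra_alt) (auto simp: degree_pCons_eq_if)
  then obtain z where z: "poly (?C p) z = 0"
    by auto
  show thesis
  proof (cases "Im z = 0")
    case True
    then have "z = of_real (Re z)"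
      by (simp add: complex_eq_iff)
    moreover have "poly (?C p) (of_real x) = of_real (poly p x)" for x
      by (induction p) (simp_all add: map_poly_pCons)
    ultimately have "poly p (Re z) = 0"
      using z by (metis of_real_eq_0_iff)
    then show thesis
      using that(1) by (auto simp: poly_eq_0_iff_dvd elim: dvdE)
  next
    case False
    define a b where "a = Re z" "b = Im z"
    define d where "d = [:a\<^sup>2 + b\<^sup>2, - 2 * a, 1:]"
    have d_z: "poly (?C d) z = 0"
      by (simp add: d_def a_b_def map_poly_pCons complex_eq_iff power2_eq_square algebra_simps)
    have "degree d = 2"
      by (simp add: d_def)
    then have "d \<noteq> 0" 
      by auto
    then have "p mod d = 0 \<or> degree (p mod d) < 2"
      using degree_mod_less[of d p] \<open>degree d = 2\<close> by auto
    then have deg: "degree (p mod d) \<le> 1"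
      by auto
    define r s where "r = coeff (p mod d) 0" "s = coeff (p mod d) 1"
    have rs: "p mod d = [:r, s:]"
    proof (rule poly_eqI)
      fix n
      show "coeff (p mod d) n = coeff [:r, s:] n"
        using deg by (auto simp: r_s_def coeff_pCons coeff_eq_0 numeral_2_eq_2 split: nat.splits)
    qed
    have "poly (?C (p div d * d + p mod d)) z = 0"
      using z by simp
    then have "poly (?C (p mod d)) z = 0"
      by (simp only: poly_of_real_add poly_of_real_mult d_z) simp
    then have "of_real r + z * of_real s = 0"
      by (simp add: rs map_poly_pCons)
    then have "r = 0 \<and> s = 0"
      using False by (auto simp: complex_eq_iff)
    then have "d dvd p"
      using rs by (simp add: dvd_eq_mod_eq_0)
    then show thesis
      using that(2) False by (auto simp: d_def a_b_def elim!: dvdE)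
  qed
qed

section \<open>The invariant subspace of hypercyclic vectors\<close>

lemma dense_range_poly_op:
  fixes T :: "'a::locally_convex_space \<Rightarrow> 'a"
  assumes T: "linear T" "continuous_on UNIV T" and hyp: "hypercyclic T"
  shows "p \<noteq> 0 \<Longrightarrow> closure (range (poly_op T p)) = UNIV"
proof (induction "degree p" arbitrary: p rule: less_induct)
  case less
  note simps = poly_op_pCons[OF T(1)] poly_op_0[OF T(1)] linear_0[OF T(1)]
  have step: ?case if p: "p = d * q" and d: "degree d > 0" "closure (range (poly_op T d)) = UNIV"
    for d q
  proof -
    have "d \<noteq> 0" "q \<noteq> 0"
      using p less.prems by auto
    then have "degree q < degree p"
      using d(1) by (simp add: p degree_mult_eq)
    then have "closure (range (poly_op T q)) = UNIV"
      using less.hyps \<open>q \<noteq> 0\<close> by blast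
    then have "closure (poly_op T d ` range (poly_op T q)) = UNIV"
      by (rule dense_image[OF continuous_on_poly_op[OF T] d(2)])
    then show ?thesis
      by (simp add: p poly_op_mult[OF T(1)] image_image)
  qed
  show ?case
  proof (cases "degree p = 0")
    case True
    then obtain c where c: "p = [:c:]" "c \<noteq> 0"
      using less.prems by (auto elim: degree_eq_zeroE)
    have "v = poly_op T p ((1 / c) *\<^sub>R v)" for v
      using c by (simp add: simps)
    then have "range (poly_op T p) = UNIV"
      by (metis surjI)
    then show ?thesis
      by simp
  next
    case False
    then have "degree p > 0"
      by simp
    then show ?thesis
    proof (cases rule: real_poly_factor)
      case (1 a q)
      have "poly_op T [:- a, 1:] v = T v - a *\<^sub>R v" for v
        by (simp add: simps)
      then show ?thesis
        using dense_range_linear_factor[OF T(1) hyp, of a] by (intro step[OF 1]) simp_all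
    next
      case (2 a b q)
      have "poly_op T [:a\<^sup>2 + b\<^sup>2, - 2 * a, 1:] v
          = T (T v) - (2 * a) *\<^sub>R T v + (a\<^sup>2 + b\<^sup>2) *\<^sub>R v" for v
        by (simp add: simps linear_add[OF T(1)] linear_scale[OF T(1)] linear_diff[OF T(1)])
      then show ?thesis
        using dense_range_quadratic_factor[OF T hyp 2(1), of a] by (intro step[OF 2(2)]) simp_all
    qed
  qed
qed

theorem mainTheorem2:
  fixes T :: "'a::locally_convex_space \<Rightarrow> 'a"
  assumes "linear T"
    and "continuous_on UNIV T"
    and "hypercyclic T"
  shows "\<exists>M. subspace M \<and> closure M = UNIV \<and> T ` M \<subseteq> M \<and>
           (\<forall>x\<in>M. x \<noteq> 0 \<longrightarrow> hypercyclic_vector T x)"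
proof -
  obtain x where x: "closure (Orb x T) = UNIV"
    using assms(3) by (auto simp: hypercyclic_def hypercyclic_vector_def)
  define M where "M = range (\<lambda>p. poly_op T p x)"
  have "subspace M"
  proof (rule subspaceI)
    show "0 \<in> M"
      unfolding M_def using poly_op_0[OF assms(1)] by (metis rangeI)
  next
    fix u v assume "u \<in> M" "v \<in> M"
    then show "u + v \<in> M"
      unfolding M_def using poly_op_add[OF assms(1)] by (smt (verit) imageE rangeI)
  next
    fix c u assume "u \<in> M"
    then show "c *\<^sub>R u \<in> M"
      unfolding M_def using poly_op_smult[OF assms(1)] by (smt (verit) imageE rangeI)
  qed
  moreover have "closure M = UNIV"
  proof -
    have "Orb x T \<subseteq> M"
      unfolding Orb_def M_def using poly_op_monom[OF assms(1)] by (metis image_subsetI rangeI)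
    then show ?thesis
      using x closure_mono by blast
  qed
  moreover have "T ` M \<subseteq> M"
  proof -
    have "T (poly_op T p x) = poly_op T (pCons 0 p) x" for p
      by (simp add: poly_op_pCons[OF assms(1)])
    then show ?thesis
      by (auto simp: M_def)
  qed
  moreover have "hypercyclic_vector T y" if y: "y \<in> M" "y \<noteq> 0" for y
  proof -
    obtain p where p: "y = poly_op T p x"
      using y(1) by (auto simp: M_def)
    then have "p \<noteq> 0"
      using y(2) poly_op_0[OF assms(1)] by auto
    then have "closure (poly_op T p ` Orb x T) = UNIV"
      using dense_image[OF continuous_on_poly_op dense_range_poly_op x] assms by blast
    then show ?thesis
      by (simp add: p hypercyclic_vector_def Orb_poly_op[OF assms(1)])
  qed
  ultimately show ?thesis
    by blast
qed

end
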